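(* Let $\mathcal{H}$ be a fixed $k$-uniform hypergraph that is not $k$-partite. Then, as $n\to\infty$, $$\mathrm{exco}_2(n,\mathcal{H}) = 2e(\mathcal{H},\mathcal{H}) + O(n^k),$$ where, for each $n$, $e(\mathcal{H},\mathcal{H})$ denotes the maximum number of edges in an induced subgraph of the Johnson graph $J(n,k)$, over all vertex sets $\mathcal{V}\subseteq V(J(n,k))=\binom{[n]}{k}$ which, viewed as $k$-uniform hypergraphs on $[n]$, do not contain a copy of $\mathcal{H}$.
   Context: $[n]=\{1,\dots,n\}$ and $\binom{V}{k}$ is the family of $k$-element subsets of $V$. A $k$-uniform hypergraph on $[n]$ is identified with its edge set $\mathcal{F}\subseteq\binom{[n]}{k}$. For $E\subseteq[n]$, $d(E)$ is the number of edges of $\mathcal{F}$ containing $E$. The codegree squared sum is $\mathrm{co}_2(\mathcal{F})=\sum_{E\in\binom{[n]}{k-1}}d(E)^2$. A hypergraph is $\mathcal{H}$-free if it contains no copy of $\mathcal{H}$ (as a not necessarily induced subhypergraph). $\mathrm{exco}_2(n,\mathcal{H})$ is the maximum of $\mathrm{co}_2(\mathcal{F})$ over all $\mathcal{H}$-free $k$-uniform hypergraphs $\mathcal{F}$ on $n$ vertices. A $k$-uniform hypergraph is $k$-partite if its vertex set can be partitioned into $k$ parts such that every edge has exactly one vertex in each part. The Johnson graph $J(n,k)$ has vertex set $\binom{[n]}{k}$, with $A,B$ adjacent if and only if $|A\cap B|=k-1$. *)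

theory Defs
  imports Complex_Main "HOL-Library.Ramsey" "HOL-Library.Disjoint_Sets" "HOL-Library.Landau_Symbols"
begin

text \<open>The family of \<open>k\<close>-element subsets of \<open>V\<close> is \<^term>\<open>nsets V k\<close>.\<close>

definition uniform_hypergraph :: "nat \<Rightarrow> 'a set \<Rightarrow> 'a set set \<Rightarrow> bool" where
  "uniform_hypergraph k V E \<longleftrightarrow> finite V \<and> E \<subseteq> nsets V k"

text \<open>Parts may be empty, so for \<open>k \<ge> 1\<close> every hypergraph without edges is \<open>k\<close>-partite.\<close>

definition k_partite :: "nat \<Rightarrow> 'a set \<Rightarrow> 'a set set \<Rightarrow> bool" where
  "k_partite k V E \<longleftrightarrow>
     (\<exists>P :: nat \<Rightarrow> 'a set. disjoint_family_on P {..<k} \<and> (\<Union>i<k. P i) = V \<and>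
        (\<forall>e\<in>E. \<forall>i<k. card (e \<inter> P i) = 1))"

definition contains_copy :: "'b set \<Rightarrow> 'b set set \<Rightarrow> 'a set \<Rightarrow> 'a set set \<Rightarrow> bool" where
  "contains_copy W F V E \<longleftrightarrow>
     (\<exists>f. inj_on f V \<and> f ` V \<subseteq> W \<and> (\<forall>e\<in>E. f ` e \<in> F))"

definition free_families :: "nat \<Rightarrow> nat \<Rightarrow> 'a set \<Rightarrow> 'a set set \<Rightarrow> nat set set set" where
  "free_families n k V E = {F. F \<subseteq> nsets {1..n} k \<and> \<not> contains_copy {1..n} F V E}"

definition deg :: "'b set set \<Rightarrow> 'b set \<Rightarrow> nat" where
  "deg F S = card {e \<in> F. S \<subseteq> e}"

definition co2 :: "nat \<Rightarrow> nat \<Rightarrow> nat set set \<Rightarrow> nat" where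
  "co2 n k F = (\<Sum>S \<in> nsets {1..n} (k - 1). (deg F S)\<^sup>2)"

text \<open>The two maxima below range over finite sets, which are nonempty whenever the forbidden
  hypergraph has an edge (the empty family is then free).\<close>

definition exco2 :: "nat \<Rightarrow> nat \<Rightarrow> 'a set \<Rightarrow> 'a set set \<Rightarrow> nat" where
  "exco2 n k V E = Max (co2 n k ` free_families n k V E)"

text \<open>Edges are unordered pairs. For \<open>k \<ge> 1\<close> adjacency is irreflexive,
  as \<^term>\<open>card (A \<inter> A) = k\<close> for every vertex \<open>A\<close>.\<close>

definition johnson_edges :: "nat \<Rightarrow> nat \<Rightarrow> nat set set set" where
  "johnson_edges n k =
     {{A, B} | A B. A \<in> nsets {1..n} k \<and> B \<in> nsets {1..n} k \<and> card (A \<inter> B) = k - 1}"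

definition induced_edges :: "'v set set \<Rightarrow> 'v set \<Rightarrow> 'v set set" where
  "induced_edges G W = {e \<in> G. e \<subseteq> W}"

definition johnson_max_edges :: "nat \<Rightarrow> nat \<Rightarrow> 'a set \<Rightarrow> 'a set set \<Rightarrow> nat" where
  "johnson_max_edges n k V E =
     Max ((\<lambda>W. card (induced_edges (johnson_edges n k) W)) ` free_families n k V E)"

end

theory Submission imports Defs begin

text \<open>
  Expand each \<open>(deg F S)\<^sup>2\<close> as the number of ordered pairs \<open>(A, B)\<close> of edges of \<open>F\<close> that both
  contain \<open>S\<close>, and sum over \<open>S\<close>. A pair \<open>(A, B)\<close> is then counted once for every
  \<open>(k - 1)\<close>-subset of \<open>A \<inter> B\<close>: that is \<open>k\<close> times if \<open>A = B\<close>, once if \<open>A\<close> and \<open>B\<close> are adjacent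
  in the Johnson graph, and never otherwise. Adjacent pairs come in two orders, so, for \<open>e(F)\<close>
  the number of edges that the Johnson graph induces on \<open>F\<close>,
  \<open>co2 n k F = k * card F + 2 * e(F)\<close> exactly (lemma \<open>co2_eq_card_plus_johnson_edges\<close>).

  The term \<open>k * card F\<close> lies between \<open>0\<close> and \<open>k * n ^ k\<close> for every \<open>F\<close>. Two functions that
  differ by at most \<open>k * n ^ k\<close> on a common finite nonempty set have maxima that differ by at most
  as much, which is the claim. The common set is nonempty because a forbidden hypergraph that is
  not \<open>k\<close>-partite has an edge, so that the empty family is free.
\<close>

lemma card_johnson_adjacent_pairs:
  assumes F: "F \<subseteq> nsets {1..n} k" and k: "k \<ge> 1"
  shows "card {(A, B) \<in> F \<times> F. card (A \<inter> B) = k - 1}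
       = 2 * card (induced_edges (johnson_edges n k) F)"
proof -
  define P where "P = {(A, B) \<in> F \<times> F. card (A \<inter> B) = k - 1}"
  have "finite F" using F finite_imp_finite_nsets finite_subset by blast
  then have finP: "finite P"
    unfolding P_def by (auto intro: finite_subset[of _ "F \<times> F"])
  have img: "(\<lambda>(A, B). {A, B}) ` P = induced_edges (johnson_edges n k) F"
  proof (rule set_eqI, rule iffI)
    fix e assume "e \<in> (\<lambda>(A, B). {A, B}) ` P"
    then obtain A B where AB: "A \<in> F" "B \<in> F" "card (A \<inter> B) = k - 1" "e = {A, B}"
      unfolding P_def by auto
    then show "e \<in> induced_edges (johnson_edges n k) F"
      using F unfolding induced_edges_def johnson_edges_def by blast
  next
    fix e assume "e \<in> induced_edges (johnson_edges n k) F"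
    then obtain A B where AB: "A \<in> F" "B \<in> F" "card (A \<inter> B) = k - 1" "e = {A, B}"
      unfolding induced_edges_def johnson_edges_def by auto
    then have "(A, B) \<in> P" unfolding P_def by simp
    then show "e \<in> (\<lambda>(A, B). {A, B}) ` P" using AB(4) by (auto intro!: image_eqI[of _ _ "(A, B)"])
  qed
  have fibre: "card {p \<in> P. (\<lambda>(A, B). {A, B}) p = e} = 2" if e: "e \<in> (\<lambda>(A, B). {A, B}) ` P" for e
  proof -
    obtain A B where AB: "(A, B) \<in> P" "e = {A, B}" using e by auto
    have "A \<noteq> B" using AB(1) F k unfolding P_def nsets_def by auto
    moreover have "{p \<in> P. (\<lambda>(A, B). {A, B}) p = e} = {(A, B), (B, A)}"
      using AB unfolding P_def by (auto simp: doubleton_eq_iff Int_commute)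
    ultimately show ?thesis by simp
  qed
  have "card P = (\<Sum>p\<in>P. 1)" by simp
  also have "\<dots> = (\<Sum>e \<in> (\<lambda>(A, B). {A, B}) ` P. card {p \<in> P. (\<lambda>(A, B). {A, B}) p = e})"
    by (subst sum.image_gen[OF finP, of _ "\<lambda>(A, B). {A, B}"]) simp
  also have "\<dots> = 2 * card (induced_edges (johnson_edges n k) F)"
    using fibre by (simp add: img)
  finally show ?thesis unfolding P_def .
qed

lemma card_common_facets:
  assumes A: "A \<in> nsets X k" and B: "B \<in> nsets X k" and k: "k \<ge> 1"
  shows "card {S \<in> nsets X (k - 1). S \<subseteq> A \<and> S \<subseteq> B}
       = (if A = B then k else 0) + (if card (A \<inter> B) = k - 1 then 1 else 0)"
proof -
  have cards: "finite A" "finite B" "card A = k" "card B = k" "A \<subseteq> X"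
    using A B by (auto simp: nsets_def)
  have "{S \<in> nsets X (k - 1). S \<subseteq> A \<and> S \<subseteq> B} = nsets (A \<inter> B) (k - 1)"
    using cards unfolding nsets_def by auto
  then have count: "card {S \<in> nsets X (k - 1). S \<subseteq> A \<and> S \<subseteq> B} = card (A \<inter> B) choose (k - 1)"
    by (simp add: card_nsets)
  show ?thesis
  proof (cases "A = B")
    case True
    then show ?thesis using count cards k binomial_symmetric[of "k - 1" k] by simp
  next
    case False
    have "A \<inter> B \<subset> A" using False cards by (metis Int_lower1 Int_lower2 card_subset_eq psubsetI)
    then have "card (A \<inter> B) < k" using cards psubset_card_mono by blast
    then show ?thesis using count False by (auto simp: binomial_eq_0)
  qed
qed

text \<open>Double counting of the triples \<open>(S, A, B)\<close> with \<open>A, B \<in> F\<close> and \<open>S\<close> a common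
  \<open>(k - 1)\<close>-subset.\<close>

lemma co2_eq_card_plus_johnson_edges:
  assumes F: "F \<subseteq> nsets {1..n} k" and k: "k \<ge> 1"
  shows "co2 n k F = k * card F + 2 * card (induced_edges (johnson_edges n k) F)"
proof -
  let ?N = "nsets {1..n} (k - 1)"
  have finF: "finite F" using F finite_imp_finite_nsets finite_subset by blast
  have finN: "finite ?N" by (simp add: finite_imp_finite_nsets)
  have square: "(deg F S)\<^sup>2 = (\<Sum>p \<in> F \<times> F. if S \<subseteq> fst p \<and> S \<subseteq> snd p then 1 else 0)" for S
  proof -
    have "{e \<in> F. S \<subseteq> e} \<times> {e \<in> F. S \<subseteq> e} = {p \<in> F \<times> F. S \<subseteq> fst p \<and> S \<subseteq> snd p}"
      by auto
    then have "(deg F S)\<^sup>2 = card {p \<in> F \<times> F. S \<subseteq> fst p \<and> S \<subseteq> snd p}"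
      unfolding deg_def power2_eq_square by (metis card_cartesian_product)
    then show ?thesis using finF by (simp add: sum.If_cases Int_def)
  qed
  have "co2 n k F = (\<Sum>p \<in> F \<times> F. \<Sum>S \<in> ?N. if S \<subseteq> fst p \<and> S \<subseteq> snd p then 1 else 0)"
    unfolding co2_def square by (rule sum.swap)
  also have "\<dots> = (\<Sum>p \<in> F \<times> F. card {S \<in> ?N. S \<subseteq> fst p \<and> S \<subseteq> snd p})"
    using finN by (simp add: sum.If_cases Int_def)
  also have "\<dots> = (\<Sum>p \<in> F \<times> F. (if fst p = snd p then k else 0)
                 + (if card (fst p \<inter> snd p) = k - 1 then 1 else 0))"
    using F k by (intro sum.cong refl card_common_facets) auto
  also have "\<dots> = (\<Sum>p \<in> F \<times> F. if fst p = snd p then k else 0)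
                + (\<Sum>p \<in> F \<times> F. if card (fst p \<inter> snd p) = k - 1 then 1 else 0)"
    by (rule sum.distrib)
  also have "(\<Sum>p \<in> F \<times> F. if fst p = snd p then k else 0) = k * card F"
  proof -
    have "(\<Sum>p \<in> F \<times> F. if fst p = snd p then k else 0) = (\<Sum>A\<in>F. \<Sum>B\<in>F. if A = B then k else 0)"
      by (simp add: sum.cartesian_product case_prod_beta)
    then show ?thesis using finF by simp
  qed
  also have "(\<Sum>p \<in> F \<times> F. if card (fst p \<inter> snd p) = k - 1 then 1 else 0)
           = card {(A, B) \<in> F \<times> F. card (A \<inter> B) = k - 1}"
  proof -
    have "{(A, B) \<in> F \<times> F. card (A \<inter> B) = k - 1} = F \<times> F \<inter> {p. card (fst p \<inter> snd p) = k - 1}"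
      by auto
    then show ?thesis using finF by (simp add: sum.If_cases)
  qed
  finally show ?thesis using card_johnson_adjacent_pairs[OF F k] by simp
qed

lemma not_k_partite_imp_edges_nonempty:
  assumes "k \<ge> 1" "\<not> k_partite k V E"
  shows "E \<noteq> {}"
proof
  assume "E = {}"
  \<comment> \<open>Without edges, all vertices can go into the first part.\<close>
  moreover have "disjoint_family_on (\<lambda>i. if i = 0 then V else {}) {..<k}"
    by (auto simp: disjoint_family_on_def)
  moreover have "(\<Union>i<k. if i = 0 then V else {}) = V" using assms(1) by auto
  ultimately show False using assms(2) unfolding k_partite_def by blast
qed

lemma Max_image_double_bounds:
  fixes f g :: "'c \<Rightarrow> nat"
  assumes "finite A" "A \<noteq> {}"
    and lower: "\<And>x. x \<in> A \<Longrightarrow> 2 * g x \<le> f x"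
    and upper: "\<And>x. x \<in> A \<Longrightarrow> f x \<le> 2 * g x + c"
  shows "2 * Max (g ` A) \<le> Max (f ` A)" "Max (f ` A) \<le> 2 * Max (g ` A) + c"
proof -
  have "Max (g ` A) \<in> g ` A" using assms(1,2) by simp
  then obtain x where x: "x \<in> A" "Max (g ` A) = g x" by blast
  show "2 * Max (g ` A) \<le> Max (f ` A)"
    unfolding x(2) using lower[OF x(1)] Max_ge[OF finite_imageI[OF assms(1)] imageI[OF x(1)], of f]
    by linarith
  have "f x \<le> 2 * Max (g ` A) + c" if "x \<in> A" for x
    using upper[OF that] Max_ge[OF finite_imageI[OF assms(1)] imageI[OF that], of g] by linarith
  then show "Max (f ` A) \<le> 2 * Max (g ` A) + c"
    using assms(1,2) by simp
qed

theorem theorem1p1: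
  fixes k :: nat and V :: "'a set" and E :: "'a set set"
  assumes "k \<ge> 1"
    and "uniform_hypergraph k V E"
    and "\<not> k_partite k V E"
  shows "(\<lambda>n. real (exco2 n k V E) - 2 * real (johnson_max_edges n k V E)) \<in> O(\<lambda>n. real n ^ k)"
proof (rule bigoI[of _ "real k"], rule always_eventually, rule allI)
  fix n
  let ?e = "\<lambda>F. card (induced_edges (johnson_edges n k) F)"
  have fin: "finite (free_families n k V E)"
    unfolding free_families_def
    by (rule finite_subset[of _ "Pow (nsets {1..n} k)"]) (auto simp: finite_imp_finite_nsets)
  have "{} \<in> free_families n k V E"
    using not_k_partite_imp_edges_nonempty[OF assms(1,3)]
    by (auto simp: free_families_def contains_copy_def)
  then have nonempty: "free_families n k V E \<noteq> {}" by blast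
  have co2: "co2 n k F = k * card F + 2 * ?e F" and small: "card F \<le> n ^ k"
    if "F \<in> free_families n k V E" for F
  proof -
    have F: "F \<subseteq> nsets {1..n} k" using that by (simp add: free_families_def)
    show "co2 n k F = k * card F + 2 * ?e F"
      by (rule co2_eq_card_plus_johnson_edges[OF F assms(1)])
    have "card F \<le> n choose k"
      using card_mono[OF _ F] by (simp add: card_nsets finite_imp_finite_nsets)
    also have "\<dots> \<le> n ^ k"
      by (cases "k \<le> n") (simp_all add: binomial_le_pow binomial_eq_0)
    finally show "card F \<le> n ^ k" .
  qed
  have "2 * ?e F \<le> co2 n k F" "co2 n k F \<le> 2 * ?e F + k * n ^ k"
    if "F \<in> free_families n k V E" for F
    using co2[OF that] mult_le_mono2[OF small[OF that], of k] by linarith+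
  note bounds = Max_image_double_bounds[OF fin nonempty this]
  have "2 * johnson_max_edges n k V E \<le> exco2 n k V E"
    unfolding exco2_def johnson_max_edges_def by (rule bounds(1))
  then have "2 * real (johnson_max_edges n k V E) \<le> real (exco2 n k V E)"
    by linarith
  moreover have "exco2 n k V E \<le> 2 * johnson_max_edges n k V E + k * n ^ k"
    unfolding exco2_def johnson_max_edges_def by (rule bounds(2))
  then have "real (exco2 n k V E) \<le> real (2 * johnson_max_edges n k V E + k * n ^ k)"
    by (rule of_nat_mono)
  ultimately show "norm (real (exco2 n k V E) - 2 * real (johnson_max_edges n k V E))
      \<le> real k * norm (real n ^ k)"
    by simp
qed

end
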